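(* Let $n\ge2$ and $\varepsilon\in\{-1,0,1\}$. Let $X:M^n\to\mathbb C^n$ be a smooth Lagrangian immersion of a compact connected manifold whose boundary has two connected components, with $H+\varepsilon X^\perp=0$, $X(M)\subset\overline{\mathbb B}^{2n}$, $X(\partial M)\subset\mathbb S^{2n-1}$ and each boundary component Legendrian capillary, with contact angles $\theta_0,\theta_1\in(0,\pi)$. Write $X\circ\Phi(s,p)=\gamma(s)\psi(p)$ in the global product form described in the context, let $r=|\gamma|:[0,L]\to(0,1]$ and $r_*:=\min_{[0,L]}r$. Then $$|\cos\theta_0|=|\cos\theta_1|=r_*^n\exp\!\left(\frac{\varepsilon(1-r_*^2)}2\right).$$ If $\operatorname{dist}(X(M),0)\ge\rho_0>0$, then $$|\cos\theta_i|\ge\rho_0^n\exp\!\left(\frac{\varepsilon(1-\rho_0^2)}2\right),\qquad i=0,1.$$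
   Context: $\mathbb C^n=\mathbb R^{2n}$ carries the Euclidean inner product $\langle\cdot,\cdot\rangle$, the complex structure $J$ and the Kähler form $\omega(U,V)=\langle JU,V\rangle$; $\overline{\mathbb B}^{2n}$ is the closed unit ball and $\mathbb S^{2n-1}$ the unit sphere. $X$ is Lagrangian if $X^*\omega=0$. $H$ is the trace of the second fundamental form and $X^\perp$ the normal component of the position vector. Let $\nu$ be the outward unit conormal of $\partial M$ in $M$. A boundary component $\Sigma$ with $X(\Sigma)\subset\mathbb S^{2n-1}$ is Legendrian if $\langle JX,dX(W)\rangle=0$ for all $W\in T\Sigma$; equivalently $\nu=\sin\theta\,X+\cos\theta\,JX$ along $\Sigma$ for an angle function $\theta$. It is Legendrian capillary if $\theta$ is constant on $\Sigma$. Under the hypotheses $\sin\theta>0$, and the representative of $\theta$ in $(0,\pi)$ is used. Global product form (provided by the paper's classification theorem in the two-boundary case): there are a closed connected $(n-1)$-manifold $N$, a minimal Legendrian immersion $\psi:N\to\mathbb S^{2n-1}$ (i.e. $\langle J\psi,\psi_*W\rangle=0$, minimal in the sphere), an arclength-parametrized curve $\gamma=re^{i\phi}:[0,L]\to\mathbb C\setminus\{0\}$, $L>0$, and a diffeomorphism $\Phi:[0,L]\times N\to M$ with $X\circ\Phi(s,p)=\gamma(s)\psi(p)$. With $\gamma'=e^{i\alpha}$, $\Theta=\alpha-\phi$: $r'=\cos\Theta$, $\Theta'=(\varepsilon r-\frac nr)\sin\Theta$, $r^ne^{-\varepsilon r^2/2}\sin\Theta=E$ is a nonzero constant, $r(0)=r(L)=1$,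 $0<r<1$ on $(0,L)$, and $r$ attains its minimum at a unique point. The angles $\theta_0,\theta_1$ are those at $s=0$ and $s=L$. *)

theory Defs
  imports "HOL-Analysis.Analysis"
begin

section \<open>Smooth maps on subsets of Euclidean spaces\<close>

text \<open>\<open>Ck_on k f W\<close> is intended for open \<open>W\<close>. On an arbitrary set (relatively open
  subsets of a half-space, compact intervals), smoothness means local extendability to a smooth
  function on an open set.\<close>

primrec Ck_on ::
  "nat \<Rightarrow> ('a::euclidean_space \<Rightarrow> 'b::real_normed_vector) \<Rightarrow> 'a set \<Rightarrow> bool" where
  "Ck_on 0 f W \<longleftrightarrow> continuous_on W f"
| "Ck_on (Suc k) f W \<longleftrightarrow>
     f differentiable_on W \<and> (\<forall>v. Ck_on k (\<lambda>x. frechet_derivative f (at x) v) W)"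

definition smooth_on ::
  "'a::euclidean_space set \<Rightarrow> ('a \<Rightarrow> 'b::real_normed_vector) \<Rightarrow> bool" where
  "smooth_on S f \<longleftrightarrow>
     (\<forall>x\<in>S. \<exists>W g. open W \<and> x \<in> W \<and> (\<forall>k. Ck_on k g W) \<and> (\<forall>y\<in>W \<inter> S. g y = f y))"


section \<open>Smooth manifolds with boundary\<close>

text \<open>A chart is a pair of its domain and its coordinate map. The set \<open>H\<close> is the model:
  \<^term>\<open>UNIV\<close> for manifolds without boundary, and \<open>half_space\<close> (of dimension \<open>DIM('e) + 1\<close>)
  for manifolds with boundary. An atlas need not be maximal.\<close>

type_synonym ('p, 'a) chart = "'p set \<times> ('p \<Rightarrow> 'a)"

definition half_space :: "(real \<times> 'e::euclidean_space) set" where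
  "half_space = {x. 0 \<le> fst x}"

definition chart_in ::
  "'a::euclidean_space set \<Rightarrow> 'p topology \<Rightarrow> ('p, 'a) chart \<Rightarrow> bool" where
  "chart_in H T c \<longleftrightarrow>
     openin T (fst c) \<and> openin (top_of_set H) (snd c ` fst c) \<and>
     homeomorphic_map (subtopology T (fst c)) (top_of_set (snd c ` fst c)) (snd c)"

definition chart_inv :: "('p, 'a) chart \<Rightarrow> 'a \<Rightarrow> 'p" where
  "chart_inv c = inv_into (fst c) (snd c)"

definition smooth_manifold ::
  "'a::euclidean_space set \<Rightarrow> 'p topology \<Rightarrow> ('p, 'a) chart set \<Rightarrow> bool" where
  "smooth_manifold H T A \<longleftrightarrow>
     Hausdorff_space T \<and> second_countable T \<and>
     (\<forall>c\<in>A. chart_in H T c) \<and> (\<Union>c\<in>A. fst c) = topspace T \<and>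
     (\<forall>c\<in>A. \<forall>d\<in>A. smooth_on (snd c ` (fst c \<inter> fst d)) (snd d \<circ> chart_inv c))"

definition manifold_boundary ::
  "('p, real \<times> 'e::euclidean_space) chart set \<Rightarrow> 'p set" where
  "manifold_boundary A = {p. \<exists>c\<in>A. p \<in> fst c \<and> fst (snd c p) = 0}"

definition smooth_map ::
  "'p topology \<Rightarrow> ('p, 'a::euclidean_space) chart set \<Rightarrow>
   'q topology \<Rightarrow> ('q, 'b::euclidean_space) chart set \<Rightarrow> ('p \<Rightarrow> 'q) \<Rightarrow> bool" where
  "smooth_map T A T' B f \<longleftrightarrow>
     continuous_map T T' f \<and>
     (\<forall>c\<in>A. \<forall>d\<in>B. smooth_on (snd c ` (fst c \<inter> f -` fst d)) (snd d \<circ> f \<circ> chart_inv c))"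

definition is_diffeomorphism ::
  "'p topology \<Rightarrow> ('p, 'a::euclidean_space) chart set \<Rightarrow>
   'q topology \<Rightarrow> ('q, 'b::euclidean_space) chart set \<Rightarrow> ('p \<Rightarrow> 'q) \<Rightarrow> bool" where
  "is_diffeomorphism T A T' B f \<longleftrightarrow>
     smooth_map T A T' B f \<and>
     (\<exists>g. smooth_map T' B T A g \<and>
          (\<forall>p\<in>topspace T. g (f p) = p) \<and> (\<forall>q\<in>topspace T'. f (g q) = q))"

text \<open>The product of \<open>[0,L]\<close> with a manifold without boundary, modelled on \<open>half_space\<close>: the
  interval is covered by \<open>[0,L)\<close> with coordinate \<open>s\<close> and \<open>(0,L]\<close> with coordinate \<open>L - s\<close>.\<close>

definition cylinder_topology :: "real \<Rightarrow> 'q topology \<Rightarrow> (real \<times> 'q) topology" where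
  "cylinder_topology L T = prod_topology (top_of_set {0..L}) T"

definition cylinder_atlas ::
  "real \<Rightarrow> ('q, 'e) chart set \<Rightarrow> (real \<times> 'q, real \<times> 'e) chart set" where
  "cylinder_atlas L B =
     (\<lambda>c. ({0..<L} \<times> fst c, \<lambda>(s, q). (s, snd c q))) ` B \<union>
     (\<lambda>c. ({0<..L} \<times> fst c, \<lambda>(s, q). (L - s, snd c q))) ` B"


section \<open>Immersions into Euclidean spaces\<close>

text \<open>The tangent space at \<open>p\<close> is represented through a chart \<open>c\<close> around \<open>p\<close> by the model
  vector space: \<open>chart_deriv c X p v\<close> is \<open>dX\<close> at \<open>p\<close> applied to the tangent vector with
  coordinates \<open>v\<close>. At boundary points it is the (one-sided) derivative within the half-space.\<close>

definition chart_deriv ::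
  "('p, 'a::euclidean_space) chart \<Rightarrow> ('p \<Rightarrow> 'b::real_normed_vector) \<Rightarrow> 'p \<Rightarrow> 'a \<Rightarrow> 'b" where
  "chart_deriv c X p =
     frechet_derivative (X \<circ> chart_inv c) (at (snd c p) within (snd c ` fst c))"

definition smooth_immersion ::
  "('p, 'a::euclidean_space) chart set \<Rightarrow> ('p \<Rightarrow> 'b::real_normed_vector) \<Rightarrow> bool" where
  "smooth_immersion A X \<longleftrightarrow>
     (\<forall>c\<in>A. smooth_on (snd c ` fst c) (X \<circ> chart_inv c) \<and>
            (\<forall>p\<in>fst c. inj (chart_deriv c X p)))"

text \<open>The component of \<open>w\<close> in the orthogonal complement of the span of \<open>V\<close>.\<close>

definition normal_part :: "'b::euclidean_space set \<Rightarrow> 'b \<Rightarrow> 'b" where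
  "normal_part V w = (THE u. w - u \<in> span V \<and> (\<forall>v\<in>V. u \<bullet> v = 0))"

definition position_normal ::
  "('p, 'a::euclidean_space) chart \<Rightarrow> ('p \<Rightarrow> 'b::euclidean_space) \<Rightarrow> 'p \<Rightarrow> 'b" where
  "position_normal c X p = normal_part (range (chart_deriv c X p)) (X p)"

text \<open>The second fundamental form of \<open>X\<close> as an immersion into a submanifold of Euclidean space
  whose normal space at \<open>X p\<close> is spanned by \<open>R\<close>: the second coordinate derivative of \<open>X\<close>, projected
  onto the orthogonal complement of the image of \<open>dX\<close> together with \<open>R\<close>. For an immersion into the
  Euclidean space itself \<open>R\<close> is empty, for an immersion into the unit sphere \<open>R = {X p}\<close>.\<close>

definition second_fundamental_form ::
  "'b::euclidean_space set \<Rightarrow> ('p, 'a::euclidean_space) chart \<Rightarrow> ('p \<Rightarrow> 'b) \<Rightarrow> 'p \<Rightarrow>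
   'a \<Rightarrow> 'a \<Rightarrow> 'b" where
  "second_fundamental_form R c X p u v =
     normal_part (range (chart_deriv c X p) \<union> R)
       (chart_deriv c (\<lambda>q. chart_deriv c X q v) p u)"

definition orthonormal_frame ::
  "('p, 'a::euclidean_space) chart \<Rightarrow> ('p \<Rightarrow> 'b::euclidean_space) \<Rightarrow> 'p \<Rightarrow> ('a \<Rightarrow> 'a) \<Rightarrow> bool" where
  "orthonormal_frame c X p e \<longleftrightarrow>
     (\<forall>i\<in>Basis. \<forall>j\<in>Basis.
        chart_deriv c X p (e i) \<bullet> chart_deriv c X p (e j) = (if i = j then 1 else 0))"

text \<open>The trace with respect to the induced metric; it does not depend on the chosen frame, which
  is indexed by the standard basis of the model space.\<close>

definition mean_curvature ::
  "'b::euclidean_space set \<Rightarrow> ('p, 'a::euclidean_space) chart \<Rightarrow> ('p \<Rightarrow> 'b) \<Rightarrow> 'p \<Rightarrow> 'b" where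
  "mean_curvature R c X p =
     (let e = (SOME e. orthonormal_frame c X p e)
      in \<Sum>i\<in>Basis. second_fundamental_form R c X p (e i) (e i))"

definition outward_conormal ::
  "('p, real \<times> 'e::euclidean_space) chart \<Rightarrow> ('p \<Rightarrow> 'b::euclidean_space) \<Rightarrow> 'p \<Rightarrow> 'b" where
  "outward_conormal c X p =
     (THE \<nu>. (\<exists>v. \<nu> = chart_deriv c X p v \<and> fst v < 0) \<and> norm \<nu> = 1 \<and>
             (\<forall>w. \<nu> \<bullet> chart_deriv c X p (0, w) = 0))"


section \<open>Lagrangian and Legendrian immersions\<close>

definition complex_structure :: "complex^'n \<Rightarrow> complex^'n" where
  "complex_structure v = \<i> *s v"

definition kaehler_form :: "complex^'n \<Rightarrow> complex^'n \<Rightarrow> real" where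
  "kaehler_form u v = complex_structure u \<bullet> v"

definition lagrangian ::
  "('p, 'a::euclidean_space) chart set \<Rightarrow> ('p \<Rightarrow> complex^'n) \<Rightarrow> bool" where
  "lagrangian A X \<longleftrightarrow>
     (\<forall>c\<in>A. \<forall>p\<in>fst c. \<forall>u v.
        kaehler_form (chart_deriv c X p u) (chart_deriv c X p v) = 0)"

definition minimal_legendrian_immersion ::
  "'q topology \<Rightarrow> ('q, 'e::euclidean_space) chart set \<Rightarrow> ('q \<Rightarrow> complex^'n) \<Rightarrow> bool" where
  "minimal_legendrian_immersion T B \<psi> \<longleftrightarrow>
     smooth_immersion B \<psi> \<and> \<psi> ` topspace T \<subseteq> sphere 0 1 \<and>
     (\<forall>c\<in>B. \<forall>q\<in>fst c. \<forall>w. complex_structure (\<psi> q) \<bullet> chart_deriv c \<psi> q w = 0) \<and>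
     (\<forall>c\<in>B. \<forall>q\<in>fst c. mean_curvature {\<psi> q} c \<psi> q = 0)"

text \<open>For a boundary component \<open>\<Sigma>\<close> with constant contact angle \<open>\<theta>\<close>. In a chart, the tangent
  vectors of \<open>\<Sigma>\<close> are those with vanishing first coordinate.\<close>

definition legendrian_capillary ::
  "('p, real \<times> 'e::euclidean_space) chart set \<Rightarrow> ('p \<Rightarrow> complex^'n) \<Rightarrow> 'p set \<Rightarrow> real \<Rightarrow> bool" where
  "legendrian_capillary A X \<Sigma> \<theta> \<longleftrightarrow>
     X ` \<Sigma> \<subseteq> sphere 0 1 \<and>
     (\<forall>c\<in>A. \<forall>p\<in>fst c \<inter> \<Sigma>.
        (\<forall>w. complex_structure (X p) \<bullet> chart_deriv c X p (0, w) = 0) \<and>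
        outward_conormal c X p = sin \<theta> *\<^sub>R X p + cos \<theta> *\<^sub>R complex_structure (X p))"


section \<open>The global product form\<close>

text \<open>Here \<open>\<gamma> = r exp(i \<phi>)\<close>, \<open>\<gamma>' = exp(i \<alpha>)\<close>; the angle \<open>\<Theta>\<close> is \<open>\<alpha> - \<phi>\<close>.\<close>

definition profile_curve :: "nat \<Rightarrow> real \<Rightarrow> real \<Rightarrow> (real \<Rightarrow> complex) \<Rightarrow> bool" where
  "profile_curve n \<epsilon> L \<gamma> \<longleftrightarrow>
     0 < L \<and> smooth_on {0..L} \<gamma> \<and> (\<forall>s\<in>{0..L}. \<gamma> s \<noteq> 0) \<and>
     (\<exists>\<phi> \<alpha> :: real \<Rightarrow> real. smooth_on {0..L} \<phi> \<and> smooth_on {0..L} \<alpha> \<and>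
        (\<forall>s\<in>{0..L}.
           \<gamma> s = of_real (cmod (\<gamma> s)) * cis (\<phi> s) \<and>
           (\<gamma> has_vector_derivative cis (\<alpha> s)) (at s within {0..L}) \<and>
           ((\<lambda>t. cmod (\<gamma> t)) has_real_derivative cos (\<alpha> s - \<phi> s)) (at s within {0..L}) \<and>
           ((\<lambda>t. \<alpha> t - \<phi> t) has_real_derivative
              (\<epsilon> * cmod (\<gamma> s) - real n / cmod (\<gamma> s)) * sin (\<alpha> s - \<phi> s))
             (at s within {0..L})) \<and>
        (\<exists>E. E \<noteq> 0 \<and>
           (\<forall>s\<in>{0..L}. cmod (\<gamma> s) ^ n * exp (- \<epsilon> * (cmod (\<gamma> s))\<^sup>2 / 2) * sin (\<alpha> s - \<phi> s) = E))) \<and>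
     cmod (\<gamma> 0) = 1 \<and> cmod (\<gamma> L) = 1 \<and> (\<forall>s\<in>{0<..<L}. 0 < cmod (\<gamma> s) \<and> cmod (\<gamma> s) < 1) \<and>
     (\<exists>!s. s \<in> {0..L} \<and> (\<forall>t\<in>{0..L}. cmod (\<gamma> s) \<le> cmod (\<gamma> t)))"

definition global_product_form ::
  "real \<Rightarrow> 'p topology \<Rightarrow> ('p, real \<times> 'e::euclidean_space) chart set \<Rightarrow> ('p \<Rightarrow> complex^'n) \<Rightarrow>
   'q topology \<Rightarrow> ('q, 'e) chart set \<Rightarrow> ('q \<Rightarrow> complex^'n) \<Rightarrow>
   real \<Rightarrow> (real \<Rightarrow> complex) \<Rightarrow> (real \<times> 'q \<Rightarrow> 'p) \<Rightarrow> bool" where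
  "global_product_form \<epsilon> TM A X TN B \<psi> L \<gamma> \<Phi> \<longleftrightarrow>
     smooth_manifold UNIV TN B \<and> compact_space TN \<and> connected_space TN \<and>
     minimal_legendrian_immersion TN B \<psi> \<and>
     profile_curve CARD('n) \<epsilon> L \<gamma> \<and>
     is_diffeomorphism (cylinder_topology L TN) (cylinder_atlas L B) TM A \<Phi> \<and>
     (\<forall>s\<in>{0..L}. \<forall>q\<in>topspace TN. X (\<Phi> (s, q)) = \<gamma> s *s \<psi> q)"

end

theory Submission
  imports Defs
begin

text \<open>In the product form the outward conormal is read off from the profile curve: at a point over
  \<open>q\<close> it is \<open>- \<gamma>'(0) \<psi>(q)\<close> at the first end and \<open>\<gamma>'(L) \<psi>(q)\<close> at the second one. Comparing with
  \<open>sin \<theta> X + cos \<theta> J X\<close>, where \<open>X = \<gamma> \<psi>\<close> and \<open>|\<gamma>| = 1\<close>, gives \<open>cos \<theta>\<^sub>0 = - sin \<Theta>(0)\<close> and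
  \<open>cos \<theta>\<^sub>1 = sin \<Theta>(L)\<close>. The first integral \<open>r ^ n * exp (- \<epsilon> * r\<^sup>2 / 2) * sin \<Theta> = E\<close> now relates the ends to
  the interior minimum \<open>r\<^sub>*\<close> of \<open>r\<close>: at the ends \<open>r = 1\<close>, and at the minimum \<open>r' = cos \<Theta> = 0\<close>, so
  \<open>exp (- \<epsilon> / 2) * |cos \<theta>\<^sub>i| = |E| = r\<^sub>* ^ n * exp (- \<epsilon> * r\<^sub>*\<^sup>2 / 2)\<close> (\<open>profile_curve_end_angles\<close>).
  Since \<open>|X| = r\<close>, a lower bound on the distance to the origin bounds \<open>r\<^sub>*\<close> from below, and
  \<open>t ^ n * exp (\<epsilon> * (1 - t\<^sup>2) / 2)\<close> is increasing on \<open>[0,1]\<close>.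

  Most of the work goes into the formula for the conormal, \<open>outward_conormal_product\<close>. The conormal
  is formed in a chart of \<open>M\<close>, whereas the product structure is visible only in the charts of the
  cylinder, so one has to know that the coordinate change preserves the boundary directions and
  the side of the boundary to which a vector points. This is \<open>half_space_diffeo_derivative\<close>; it
  rests on the first-order condition for the first coordinate, which is minimal on the boundary.\<close>


section \<open>Calculus at the boundary of a half-space\<close>

lemma smooth_on_imp_differentiable:
  assumes "smooth_on S f" "x \<in> S"
  shows "f differentiable (at x within S)"
proof -
  obtain W g where W: "open W" "x \<in> W" "\<forall>k. Ck_on k g W" "\<forall>y\<in>W \<inter> S. g y = f y"
    using assms unfolding smooth_on_def by blast
  obtain e where e: "0 < e" "\<And>y. dist y x < e \<Longrightarrow> y \<in> W"
    using W(1,2) unfolding open_dist by blast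
  have "Ck_on (Suc 0) g W" using W(3) by blast
  then have "g differentiable_on W" by simp
  then have "g differentiable (at x)"
    using W(1,2) by (simp add: differentiable_on_eq_differentiable_at)
  then obtain g' where "(g has_derivative g') (at x)" by (auto simp: differentiable_def)
  then have "(g has_derivative g') (at x within S)" by (rule has_derivative_at_withinI)
  then have "(f has_derivative g') (at x within S)"
    by (rule has_derivative_transform_within[OF _ e(1) assms(2)]) (use W(4) e(2) in auto)
  then show ?thesis by (auto simp: differentiable_def)
qed

lemma half_space_segment:
  fixes z v :: "real \<times> 'e::euclidean_space"
  assumes "openin (top_of_set half_space) V" "z \<in> V"
  obtains e where "e > 0"
    "\<And>t. \<bar>t\<bar> < e \<Longrightarrow> 0 \<le> fst z + t * fst v \<Longrightarrow> z + t *\<^sub>R v \<in> V"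
proof -
  obtain O' where O: "open O'" "V = half_space \<inter> O'"
    using assms(1) by (auto simp: openin_open)
  then obtain d where d: "d > 0" "ball z d \<subseteq> O'"
    using assms(2) open_contains_ball by blast
  show ?thesis
  proof (rule that)
    show "d / (norm v + 1) > 0" using d(1) by (simp add: add_nonneg_pos)
  next
    fix t assume t: "\<bar>t\<bar> < d / (norm v + 1)" "0 \<le> fst z + t * fst v"
    have "\<bar>t\<bar> * norm v \<le> \<bar>t\<bar> * (norm v + 1)" by (simp add: mult_left_mono)
    also have "\<dots> < d" using t(1) by (simp add: pos_less_divide_eq add_nonneg_pos)
    finally have "z + t *\<^sub>R v \<in> ball z d" by (simp add: dist_norm)
    then show "z + t *\<^sub>R v \<in> V" using d(2) O(2) t(2) by (auto simp: half_space_def)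
  qed
qed

lemma half_space_derivative_unique:
  fixes f :: "real \<times> 'e::euclidean_space \<Rightarrow> 'b::real_normed_vector"
  assumes V: "openin (top_of_set half_space) V" "z \<in> V"
    and f: "(f has_derivative f') (at z within V)" "(f has_derivative f'') (at z within V)"
  shows "f' = f''"
proof (rule frechet_derivative_unique_within[OF f])
  fix i :: "real \<times> 'e" and e :: real
  assume i: "i \<in> Basis" and e: "0 < e"
  obtain d where d: "d > 0" "\<And>t. \<bar>t\<bar> < d \<Longrightarrow> 0 \<le> fst z + t * fst i \<Longrightarrow> z + t *\<^sub>R i \<in> V"
    using half_space_segment[OF V] by blast
  have "0 \<le> fst z" using V by (auto simp: openin_open half_space_def)
  moreover have "0 \<le> fst i" using i by (auto simp: Basis_prod_def)
  ultimately have "z + (min d e / 2) *\<^sub>R i \<in> V"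
    by (intro d(2)) (use d(1) e in auto)
  then show "\<exists>d. 0 < \<bar>d\<bar> \<and> \<bar>d\<bar> < e \<and> z + d *\<^sub>R i \<in> V"
    using d(1) e by (intro exI[of _ "min d e / 2"]) auto
qed

text \<open>First-order condition at a boundary minimum: inward directions give a one-sided minimum
  at parameter \<open>0\<close>, and for tangential directions both \<open>v\<close> and \<open>- v\<close> point inward.\<close>

lemma half_space_minimum_derivative:
  fixes h :: "real \<times> 'e::euclidean_space \<Rightarrow> real"
  assumes V: "openin (top_of_set half_space) V" "z \<in> V"
    and h: "(h has_derivative h') (at z within V)" and min: "\<And>y. y \<in> V \<Longrightarrow> h z \<le> h y"
  shows "0 \<le> fst v \<Longrightarrow> 0 \<le> h' v" "fst v = 0 \<Longrightarrow> h' v = 0"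
proof -
  have nonneg: "0 \<le> h' v" if v: "0 \<le> fst v" for v
  proof (rule ccontr)
    assume neg: "\<not> 0 \<le> h' v"
    obtain e where e: "e > 0" "\<And>t. \<bar>t\<bar> < e \<Longrightarrow> 0 \<le> fst z + t * fst v \<Longrightarrow> z + t *\<^sub>R v \<in> V"
      using half_space_segment[OF V] by blast
    have "0 \<le> fst z" using V by (auto simp: openin_open half_space_def)
    then have inV: "z + t *\<^sub>R v \<in> V" if "t \<in> {0..<e}" for t
      using that v by (intro e(2)) auto
    have lin: "linear h'" using h by (rule has_derivative_linear)
    have "((\<lambda>t. z + t *\<^sub>R v) has_derivative (\<lambda>t. t *\<^sub>R v)) (at 0 within {0..<e})"
      by (auto intro!: derivative_eq_intros)
    moreover have "(h has_derivative h') (at (z + 0 *\<^sub>R v) within (\<lambda>t. z + t *\<^sub>R v) ` {0..<e})"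
      using inV h by (auto intro: has_derivative_subset)
    ultimately have "((\<lambda>t. h (z + t *\<^sub>R v)) has_derivative (\<lambda>t. h' (t *\<^sub>R v))) (at 0 within {0..<e})"
      by (rule has_derivative_in_compose)
    then have "((\<lambda>t. h (z + t *\<^sub>R v)) has_real_derivative h' v) (at 0 within {0..<e})"
      by (simp add: has_field_derivative_def linear_scale[OF lin] mult_commute_abs)
    from has_real_derivative_neg_dec_right[OF this] neg
    obtain d where d: "d > 0" "\<And>t. t > 0 \<Longrightarrow> t \<in> {0..<e} \<Longrightarrow> t < d \<Longrightarrow> h (z + t *\<^sub>R v) < h z"
      by auto
    have "h (z + (min d e / 2) *\<^sub>R v) < h z" by (rule d(2)) (use d(1) e(1) in auto)
    moreover have "h z \<le> h (z + (min d e / 2) *\<^sub>R v)"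
      by (intro min inV) (use d(1) e(1) in auto)
    ultimately show False by simp
  qed
  show "0 \<le> fst v \<Longrightarrow> 0 \<le> h' v" by (rule nonneg)
  assume "fst v = 0"
  then have "0 \<le> h' v" "0 \<le> h' (- v)" using nonneg[of v] nonneg[of "- v"] by auto
  then show "h' v = 0" using linear_neg[OF has_derivative_linear[OF h], of v] by simp
qed

text \<open>A change of boundary coordinates respects the inward direction and the tangent space of the
  boundary. Only the base point has to be known to go to the boundary: there the first
  coordinate of the map, being nonnegative, has a minimum, and the same applies to the inverse map.
  Were the image of the inward vector \<open>(1, 0)\<close> tangential, then so would be its image under
  the inverse derivative, which is \<open>(1, 0)\<close> itself.\<close>

lemma half_space_diffeo_derivative:
  fixes G :: "real \<times> 'e::euclidean_space \<Rightarrow> real \<times> 'f::euclidean_space"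
  assumes V: "openin (top_of_set half_space) V" "z \<in> V" and U: "openin (top_of_set half_space) U"
    and G: "G ` V \<subseteq> U" "K ` U \<subseteq> V" "\<And>y. y \<in> V \<Longrightarrow> K (G y) = y" "\<And>y. y \<in> U \<Longrightarrow> G (K y) = y"
    and der: "(G has_derivative G') (at z within V)" "(K has_derivative K') (at (G z) within U)"
    and bd: "fst z = 0" "fst (G z) = 0"
  shows "0 < fst (G' (1, 0))" "\<exists>w'. G' (0, w') = (0, w)"
proof -
  have Gz: "G z \<in> U" "K (G z) = z" using V(2) G(1,3) by auto
  have half: "V \<subseteq> half_space" "U \<subseteq> half_space" using V(1) U by (auto simp: openin_open)
  have comp: "((K \<circ> G) has_derivative (K' \<circ> G')) (at z within V)"
    by (rule diff_chain_within[OF der(1) has_derivative_subset[OF der(2) G(1)]])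
  have comp2: "((G \<circ> K) has_derivative (G' \<circ> K')) (at (G z) within U)"
    by (rule diff_chain_within[OF der(2) has_derivative_subset[OF _ G(2)]]) (simp add: der(1) Gz(2))
  have "((\<lambda>y. y) has_derivative (K' \<circ> G')) (at z within V)"
    by (rule has_derivative_transform[OF V(2) _ comp]) (simp add: G(3))
  from half_space_derivative_unique[OF V this has_derivative_ident]
  have KG: "K' (G' v) = v" for v by (metis comp_apply)
  have "((\<lambda>y. y) has_derivative (G' \<circ> K')) (at (G z) within U)"
    by (rule has_derivative_transform[OF Gz(1) _ comp2]) (simp add: G(4))
  from half_space_derivative_unique[OF U Gz(1) this has_derivative_ident]
  have GK: "G' (K' v) = v" for v by (metis comp_apply)
  have minG: "fst (G z) \<le> fst (G y)" if "y \<in> V" for y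
    using that G(1) half bd(2) by (auto simp: half_space_def)
  have minK: "fst (K (G z)) \<le> fst (K y)" if "y \<in> U" for y
    using that G(2) half bd(1) Gz(2) by (auto simp: half_space_def)
  note fG = half_space_minimum_derivative[OF V has_derivative_fst[OF der(1)] minG]
  note fK = half_space_minimum_derivative[OF U Gz(1) has_derivative_fst[OF der(2)] minK]
  have "fst (G' (1, 0)) \<noteq> 0"
  proof
    assume "fst (G' (1, 0)) = 0"
    then have "fst (K' (G' (1, 0))) = 0" by (intro fK(2))
    then show False by (simp add: KG)
  qed
  moreover have "0 \<le> fst (G' (1, 0))" by (intro fG(1)) simp_all
  ultimately show "0 < fst (G' (1, 0))" by simp
  have "fst (K' (0, w)) = 0" by (intro fK(2)) simp_all
  then have "G' (0, snd (K' (0, w))) = (0, w)" using GK[of "(0, w)"] by (metis prod.collapse)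
  then show "\<exists>w'. G' (0, w') = (0, w)" by blast
qed


section \<open>Charts and the outward conormal\<close>

lemma chart_inj: "chart_in H T c \<Longrightarrow> inj_on (snd c) (fst c)"
  using openin_subset[of T "fst c"]
  by (simp add: chart_in_def homeomorphic_eq_everything_map Int_absorb1)

lemma chart_inv_chart: "chart_in H T c \<Longrightarrow> p \<in> fst c \<Longrightarrow> chart_inv c (snd c p) = p"
  by (simp add: chart_inj chart_inv_def)

lemma openin_chart_image:
  assumes c: "chart_in H T c" and Q: "openin T Q"
  shows "openin (top_of_set H) (snd c ` (fst c \<inter> Q))"
proof -
  have "openin (subtopology T (fst c)) (fst c \<inter> Q)"
    using Q by (auto simp: openin_subtopology)
  moreover have "open_map (subtopology T (fst c)) (top_of_set (snd c ` fst c)) (snd c)"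
    using c by (simp add: chart_in_def homeomorphic_imp_open_map)
  ultimately have "openin (top_of_set (snd c ` fst c)) (snd c ` (fst c \<inter> Q))"
    by (simp add: open_map_def)
  then show ?thesis using c openin_trans by (fastforce simp: chart_in_def)
qed

lemma continuous_map_chart_inv:
  assumes "chart_in H T c"
  shows "continuous_map (top_of_set (snd c ` fst c)) T (chart_inv c)"
proof -
  have ts: "topspace (subtopology T (fst c)) = fst c"
    using assms openin_subset[of T "fst c"] by (simp add: chart_in_def Int_absorb1)
  obtain g where g: "homeomorphic_maps (subtopology T (fst c)) (top_of_set (snd c ` fst c)) (snd c) g"
    using assms by (auto simp: chart_in_def homeomorphic_map_maps)
  have "continuous_map (top_of_set (snd c ` fst c)) (subtopology T (fst c)) (chart_inv c)"
  proof (rule continuous_map_eq)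
    show "continuous_map (top_of_set (snd c ` fst c)) (subtopology T (fst c)) g"
      using g by (simp add: homeomorphic_maps_def)
    show "g x = chart_inv c x" if "x \<in> topspace (top_of_set (snd c ` fst c))" for x
      using g that ts chart_inv_chart[OF assms] by (auto simp: homeomorphic_maps_def)
  qed
  then show ?thesis by (simp add: continuous_map_in_subtopology)
qed

lemma chart_deriv_works:
  assumes "smooth_on (snd c ` fst c) (X \<circ> chart_inv c)" "p \<in> fst c"
  shows "((X \<circ> chart_inv c) has_derivative chart_deriv c X p) (at (snd c p) within snd c ` fst c)"
  unfolding chart_deriv_def
  using smooth_on_imp_differentiable[OF assms(1)] assms(2) by (simp add: frechet_derivative_works)

text \<open>For uniqueness: if \<open>dX v\<close> and \<open>dX u\<close> are both outward unit normals to the boundary, then the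
  combination of \<open>v\<close> and \<open>u\<close> without first coordinate is tangential to the boundary, so its image
  is orthogonal to itself and vanishes. Hence the two normals are positive multiples of one another.\<close>

lemma outward_conormal_eqI:
  fixes X :: "'p \<Rightarrow> 'b::euclidean_space" and v :: "real \<times> 'e::euclidean_space"
  assumes lin: "linear (chart_deriv c X p)"
    and v: "\<nu> = chart_deriv c X p v" "fst v < 0" and unit: "norm \<nu> = 1"
    and orth: "\<And>w. \<nu> \<bullet> chart_deriv c X p (0, w) = 0"
  shows "outward_conormal c X p = \<nu>"
  unfolding outward_conormal_def
proof (rule the_equality)
  show "(\<exists>v. \<nu> = chart_deriv c X p v \<and> fst v < 0) \<and> norm \<nu> = 1 \<and>
        (\<forall>w. \<nu> \<bullet> chart_deriv c X p (0, w) = 0)"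
    using assms by blast
next
  fix \<mu>
  assume asm: "(\<exists>v. \<mu> = chart_deriv c X p v \<and> fst v < 0) \<and> norm \<mu> = 1 \<and>
        (\<forall>w. \<mu> \<bullet> chart_deriv c X p (0, w) = 0)"
  then obtain u where u: "\<mu> = chart_deriv c X p u" "fst u < 0" by blast
  define d where "d = fst v *\<^sub>R \<mu> - fst u *\<^sub>R \<nu>"
  have "fst v *\<^sub>R u - fst u *\<^sub>R v = (0, snd (fst v *\<^sub>R u - fst u *\<^sub>R v))"
    by (simp add: prod_eq_iff)
  then have "d = chart_deriv c X p (0, snd (fst v *\<^sub>R u - fst u *\<^sub>R v))"
    unfolding d_def u(1) v(1)
    by (metis linear_diff[OF lin] linear_scale[OF lin])
  then have "\<mu> \<bullet> d = 0" "\<nu> \<bullet> d = 0" using asm orth by auto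
  then have "d \<bullet> d = 0" by (simp add: d_def inner_diff_left)
  then have eq: "fst v *\<^sub>R \<mu> = fst u *\<^sub>R \<nu>" by (simp add: d_def)
  then have "norm (fst v *\<^sub>R \<mu>) = norm (fst u *\<^sub>R \<nu>)" by simp
  then have "fst v = fst u" using asm unit u(2) v(2) by simp
  then show "\<mu> = \<nu>" using eq u(2) by simp
qed


section \<open>Complex multiples of a vector\<close>

lemma inner_vector_scalar_mult:
  fixes u v :: "complex^'n"
  shows "(a *s u) \<bullet> (b *s v) =
    Re (a * cnj b) * (u \<bullet> v) + Im (a * cnj b) * (complex_structure u \<bullet> v)"
proof -
  have "(a *s u) \<bullet> (b *s v) = (\<Sum>i\<in>UNIV. (a * u $ i) \<bullet> (b * v $ i))"
    by (simp add: inner_vec_def)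
  also have "\<dots> = (\<Sum>i\<in>UNIV. Re (a * cnj b) * (u $ i \<bullet> v $ i) +
      Im (a * cnj b) * ((\<i> * u $ i) \<bullet> v $ i))"
    by (intro sum.cong refl) (simp add: inner_complex_def algebra_simps)
  also have "\<dots> = Re (a * cnj b) * (u \<bullet> v) + Im (a * cnj b) * (complex_structure u \<bullet> v)"
    by (simp add: inner_vec_def complex_structure_def sum.distrib sum_distrib_left)
  finally show ?thesis .
qed

lemma norm_vector_scalar_mult:
  fixes u :: "complex^'n"
  shows "norm (a *s u) = cmod a * norm u"
proof -
  have "(norm (a *s u))\<^sup>2 = (cmod a * norm u)\<^sup>2"
    by (simp add: power2_norm_eq_inner[of "a *s u"] inner_vector_scalar_mult complex_mult_cnj
        cmod_power2 power_mult_distrib power2_norm_eq_inner)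
  then show ?thesis by simp
qed

lemma bounded_bilinear_vector_scalar_mult:
  "bounded_bilinear (\<lambda>a (u :: complex^'n). a *s u)"
proof
  show "\<exists>K. \<forall>a (b :: complex^'n). norm (a *s b) \<le> norm a * norm b * K"
    by (intro exI[of _ 1]) (simp add: norm_vector_scalar_mult)
qed (simp_all add: vec_eq_iff algebra_simps)


lemma sphere_derivative_orthogonal:
  fixes f :: "'a::real_normed_vector \<Rightarrow> 'b::real_inner"
  assumes S: "open S" "x \<in> S" and f: "(f has_derivative f') (at x within S)"
    and unit: "\<And>y. y \<in> S \<Longrightarrow> norm (f y) = 1"
  shows "f x \<bullet> f' w = 0"
proof -
  have "((\<lambda>y. f y \<bullet> f y) has_derivative (\<lambda>h. f x \<bullet> f' h + f' h \<bullet> f x)) (at x within S)"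
    by (rule has_derivative_inner[OF f f])
  then have "((\<lambda>y. 1) has_derivative (\<lambda>h. f x \<bullet> f' h + f' h \<bullet> f x)) (at x within S)"
    by (rule has_derivative_transform[OF S(2), rotated]) (simp add: unit dot_square_norm)
  then have "((\<lambda>y. 1) has_derivative (\<lambda>h. f x \<bullet> f' h + f' h \<bullet> f x)) (at x)"
    by (simp only: at_within_open[OF S(2,1)])
  from has_derivative_unique[OF this has_derivative_const]
  have "f x \<bullet> f' w + f' w \<bullet> f x = 0" by (rule fun_cong)
  then show ?thesis by (simp add: inner_commute)
qed

text \<open>The two real coefficients of the conormal are the components of \<open>- (b * cnj a)\<close>, because
  multiplication by \<open>sin \<theta> + i cos \<theta>\<close> turns \<open>a\<close> into \<open>- b\<close>.\<close>

lemma capillary_angle: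
  fixes v :: "complex^'n"
  assumes eq: "- (b *s v) = sin \<theta> *\<^sub>R (a *s v) + cos \<theta> *\<^sub>R complex_structure (a *s v)"
    and unit: "norm v = 1" "cmod a = 1"
  shows "cos \<theta> = - Im (b * cnj a)"
proof -
  define m where "m = Complex (sin \<theta>) (cos \<theta>)"
  have "(b + m * a) *s v = 0"
    using eq by (simp add: vec_eq_iff complex_structure_def complex_eq_iff m_def algebra_simps)
  then have "cmod (b + m * a) = 0"
    using norm_vector_scalar_mult[of "b + m * a" v] unit(1) by simp
  then have "b = - (m * a)" by (simp add: add_eq_0_iff2)
  then have "b * cnj a = - (m * (a * cnj a))" by simp
  also have "a * cnj a = 1" using complex_norm_square[of a] unit(2) by simp
  finally show ?thesis by (simp add: m_def)
qed


section \<open>The conormal of a product of a curve and a Legendrian immersion\<close>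

text \<open>Both ends of the cylinder are treated at once: \<open>\<sigma>\<close> is the coordinate of the interval counted
  from the end under consideration, and \<open>b\<close> is the inward velocity of the curve there. In the
  coordinates of the cylinder the inward normal is \<open>b \<psi>\<close>: it has unit length, and it is
  orthogonal to the boundary directions \<open>\<gamma> d\<psi>\<close> since \<open>d\<psi>\<close> is orthogonal to \<open>\<psi>\<close>
  (values on the sphere) and to \<open>J \<psi>\<close> (Legendrian), hence to all complex multiples of \<open>\<psi>\<close>. The change
  of charts from the cylinder to \<open>M\<close> preserves inward and boundary directions.\<close>

lemma outward_conormal_product:
  fixes A :: "('p, real \<times> 'e::euclidean_space) chart set" and X :: "'p \<Rightarrow> complex^'n"
    and B :: "('q, 'e) chart set"
  assumes M: "smooth_manifold half_space TM A" and X: "smooth_immersion A X"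
    and N: "smooth_manifold UNIV TN B" and \<psi>: "minimal_legendrian_immersion TN B \<psi>"
    and \<Phi>: "is_diffeomorphism (cylinder_topology L TN) (cylinder_atlas L B) TM A \<Phi>"
    and prod: "\<And>s q. s \<in> {0..L} \<Longrightarrow> q \<in> topspace TN \<Longrightarrow> X (\<Phi> (s, q)) = \<gamma> s *s \<psi> q"
    and L: "0 < L" and \<sigma>: "\<sigma> = (\<lambda>t. t) \<or> \<sigma> = (\<lambda>t. L - t)"
    and der: "((\<lambda>t. \<gamma> (\<sigma> t)) has_vector_derivative b) (at 0 within {0..<L})"
    and unit: "cmod (\<gamma> (\<sigma> 0)) = 1" "cmod b = 1"
    and q: "q \<in> topspace TN"
    and c: "c \<in> A" "\<Phi> (\<sigma> 0, q) \<in> fst c" "fst (snd c (\<Phi> (\<sigma> 0, q))) = 0"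
  shows "outward_conormal c X (\<Phi> (\<sigma> 0, q)) = - (b *s \<psi> q)"
proof -
  define p where "p = \<Phi> (\<sigma> 0, q)"
  have "q \<in> (\<Union>c\<in>B. fst c)" using N q by (simp add: smooth_manifold_def)
  then obtain d where d: "d \<in> B" "q \<in> fst d" by blast
  have dN: "chart_in UNIV TN d" and cM: "chart_in half_space TM c"
    using N M d(1) c(1) by (auto simp: smooth_manifold_def)
  have d_open: "open (snd d ` fst d)" "openin TN (fst d)" using dN by (auto simp: chart_in_def)
  have d_sub: "fst d \<subseteq> topspace TN" using d_open(2) by (rule openin_subset)
  have c_open: "openin TM (fst c)" using cM by (auto simp: chart_in_def)
  have c_sub: "fst c \<subseteq> topspace TM" using c_open by (rule openin_subset)

  \<comment> \<open>The chart of the cylinder over \<open>d\<close> at this end. As \<open>\<sigma>\<close> is an involution, it serves both as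
    the coordinate and as its inverse.\<close>
  define D where "D = (\<sigma> ` {0..<L} \<times> fst d, \<lambda>(s, q). (\<sigma> s, snd d q))"
  have invol: "\<sigma> (\<sigma> t) = t" for t using \<sigma> by auto
  have range: "\<sigma> t \<in> {0..L}" if "t \<in> {0..<L}" for t using \<sigma> that by auto
  have flip: "(\<lambda>t. L - t) ` {0..<L} = {0<..L}"
    by (auto simp: image_iff intro!: bexI[of _ "L - _"])
  have \<sigma>_image: "\<sigma> ` {0..<L} = {0..<L} \<or> \<sigma> ` {0..<L} = {0<..L}"
    using \<sigma> flip by auto
  have D_atlas: "D \<in> cylinder_atlas L B"
    using \<sigma> d(1) flip by (auto simp: D_def cylinder_atlas_def)
  have "{0..<L} = {0..L} \<inter> {..<L}" "{0<..L} = {0..L} \<inter> {0<..}" by auto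
  then have "openin (top_of_set {0..L}) {0..<L}" "openin (top_of_set {0..L}) {0<..L}"
    by (metis openin_open_Int open_lessThan, metis openin_open_Int open_greaterThan)
  then have "openin (top_of_set {0..L}) (\<sigma> ` {0..<L})" using \<sigma>_image by metis
  then have D_open: "openin (cylinder_topology L TN) (fst D)"
    using d_open(2) by (simp add: D_def cylinder_topology_def openin_prod_Times_iff)
  then have D_sub: "fst D \<subseteq> topspace (cylinder_topology L TN)" by (rule openin_subset)
  have D_inj: "inj_on (snd D) (fst D)"
    using chart_inj[OF dN] invol by (fastforce simp: D_def inj_on_def)
  have D_inv: "chart_inv D (snd D y) = y" if "y \<in> fst D" for y
    using D_inj that by (simp add: chart_inv_def)
  have D_inv_eq: "chart_inv D (t, x) = (\<sigma> t, chart_inv d x)" "(\<sigma> t, chart_inv d x) \<in> fst D"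
    if "t \<in> {0..<L}" "x \<in> snd d ` fst d" for t x
  proof -
    obtain y where y: "y \<in> fst d" "x = snd d y" using \<open>x \<in> snd d ` fst d\<close> by blast
    then have inv: "chart_inv d x = y" using chart_inv_chart[OF dN] by simp
    show mem: "(\<sigma> t, chart_inv d x) \<in> fst D" using that(1) y(1) inv by (auto simp: D_def)
    have "snd D (\<sigma> t, chart_inv d x) = (t, x)" using y inv invol by (simp add: D_def)
    then show "chart_inv D (t, x) = (\<sigma> t, chart_inv d x)" using D_inv[OF mem] by simp
  qed
  have D_image: "snd D ` fst D = {0..<L} \<times> snd d ` fst d"
    by (simp add: D_def image_paired_Times image_image invol)

  obtain g where sm\<Phi>: "smooth_map (cylinder_topology L TN) (cylinder_atlas L B) TM A \<Phi>"
    and smg: "smooth_map TM A (cylinder_topology L TN) (cylinder_atlas L B) g"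
    and g: "\<And>y. y \<in> topspace (cylinder_topology L TN) \<Longrightarrow> g (\<Phi> y) = y"
      "\<And>y. y \<in> topspace TM \<Longrightarrow> \<Phi> (g y) = y"
    using \<Phi> unfolding is_diffeomorphism_def by blast
  define V where "V = snd D ` (fst D \<inter> \<Phi> -` fst c)"
  define U where "U = snd c ` (fst c \<inter> g -` fst D)"
  define G where "G = snd c \<circ> \<Phi> \<circ> chart_inv D"
  define K where "K = snd D \<circ> g \<circ> chart_inv c"
  have smooth: "smooth_on V G" "smooth_on U K"
    using sm\<Phi> smg D_atlas c(1) unfolding smooth_map_def V_def U_def G_def K_def by blast+

  have "openin TM {y \<in> topspace TM. g y \<in> fst D}"
    using smg D_open openin_continuous_map_preimage unfolding smooth_map_def by blast
  then have "openin (top_of_set half_space) (snd c ` (fst c \<inter> {y \<in> topspace TM. g y \<in> fst D}))"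
    by (rule openin_chart_image[OF cM])
  also have "fst c \<inter> {y \<in> topspace TM. g y \<in> fst D} = fst c \<inter> g -` fst D" using c_sub by auto
  finally have U: "openin (top_of_set half_space) U" by (simp add: U_def)

  \<comment> \<open>\<open>?S\<close> is the image of the chart \<open>D\<close>, and \<open>?F\<close> is the inverse of \<open>D\<close> on it.\<close>
  let ?S = "{0..<L} \<times> snd d ` fst d"
  let ?F = "\<lambda>z. (\<sigma> (fst z), chart_inv d (snd z))"
  have "continuous_map (top_of_set ?S) (top_of_set {0..L}) (\<lambda>z. \<sigma> (fst z))"
    using \<sigma> by (auto simp: continuous_map_in_subtopology intro!: continuous_intros)
  moreover have "continuous_map (top_of_set ?S) (top_of_set (snd d ` fst d)) snd"
    by (auto simp: continuous_map_in_subtopology intro!: continuous_intros)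
  from continuous_map_compose[OF this continuous_map_chart_inv[OF dN]]
  have "continuous_map (top_of_set ?S) TN (\<lambda>z. chart_inv d (snd z))" by (simp add: comp_def)
  ultimately have "continuous_map (top_of_set ?S) (cylinder_topology L TN) ?F"
    by (simp add: cylinder_topology_def continuous_map_pairwise comp_def)
  from continuous_map_compose[OF this]
  have "continuous_map (top_of_set ?S) TM (\<lambda>z. \<Phi> (?F z))"
    using sm\<Phi> by (auto simp: smooth_map_def comp_def)
  from openin_continuous_map_preimage[OF this c_open]
  have "openin (top_of_set ?S) {z \<in> ?S. \<Phi> (?F z) \<in> fst c}" by simp
  also have "{z \<in> ?S. \<Phi> (?F z) \<in> fst c} = V"
  proof (intro set_eqI iffI)
    fix z assume "z \<in> {z \<in> ?S. \<Phi> (?F z) \<in> fst c}"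
    then have z: "z \<in> ?S" "\<Phi> (?F z) \<in> fst c" by auto
    then obtain y where y: "y \<in> fst D" "z = snd D y" using D_image by blast
    have "?F z = y" using z(1) D_inv_eq(1)[of "fst z" "snd z"] D_inv[OF y(1)] y(2) by auto
    then show "z \<in> V" using y z(2) by (auto simp: V_def)
  next
    fix z assume "z \<in> V"
    then obtain y where y: "y \<in> fst D" "\<Phi> y \<in> fst c" "z = snd D y" by (auto simp: V_def)
    then have "z \<in> ?S" using D_image by blast
    moreover have "?F z = y"
      using calculation D_inv_eq(1)[of "fst z" "snd z"] D_inv[OF y(1)] y(3) by auto
    ultimately show "z \<in> {z \<in> ?S. \<Phi> (?F z) \<in> fst c}" using y(2) by simp
  qed
  finally have "openin (top_of_set ?S) V" .
  moreover have "?S = half_space \<inter> ({..<L} \<times> snd d ` fst d)" by (auto simp: half_space_def)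
  then have "openin (top_of_set half_space) ?S"
    using d_open(1) by (metis openin_open_Int open_Times open_lessThan)
  ultimately have V: "openin (top_of_set half_space) V" by (rule openin_trans)

  define z where "z = (0::real, snd d q)"
  have z_S: "z \<in> ?S" using L d(2) by (simp add: z_def)
  have z_inv: "chart_inv D z = (\<sigma> 0, q)" and q_D: "(\<sigma> 0, q) \<in> fst D"
    using D_inv_eq[of 0 "snd d q"] L d(2) chart_inv_chart[OF dN d(2)] by (auto simp: z_def)
  have "z = snd D (\<sigma> 0, q)" by (simp add: z_def D_def invol)
  then have z_V: "z \<in> V" using q_D c(2) by (auto simp: V_def)
  have Gz: "G z = snd c p" by (simp add: G_def z_inv p_def)
  have GV: "G y \<in> U \<and> K (G y) = y" if y: "y \<in> V" for y
  proof -
    obtain x where x: "x \<in> fst D" "\<Phi> x \<in> fst c" "y = snd D x" using y by (auto simp: V_def)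
    have "g (\<Phi> x) = x" using x(1) D_sub g(1) by blast
    then show ?thesis
      using x chart_inv_chart[OF cM x(2)] by (auto simp: G_def K_def U_def D_inv)
  qed
  have KU: "K y \<in> V \<and> G (K y) = y" if y: "y \<in> U" for y
  proof -
    obtain x where x: "x \<in> fst c" "g x \<in> fst D" "y = snd c x" using y by (auto simp: U_def)
    have "\<Phi> (g x) = x" using x(1) c_sub g(2) by blast
    then show ?thesis
      using x chart_inv_chart[OF cM x(1)] by (auto simp: G_def K_def V_def D_inv)
  qed
  obtain G' where G': "(G has_derivative G') (at z within V)"
    using smooth_on_imp_differentiable[OF smooth(1) z_V] by (auto simp: differentiable_def)
  obtain K' where K': "(K has_derivative K') (at (G z) within U)"
    using smooth_on_imp_differentiable[OF smooth(2), of "G z"] GV[OF z_V] by (auto simp: differentiable_def)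
  have "G ` V \<subseteq> U" "K ` U \<subseteq> V" "fst z = 0" "fst (G z) = 0"
    using GV KU Gz c(3) by (auto simp: z_def p_def)
  note directions = half_space_diffeo_derivative[OF V z_V U this(1,2) _ _ G' K' this(3,4)]
  have inward: "0 < fst (G' (1, 0))" by (rule directions(1)) (use GV KU in auto)
  have tangential: "\<exists>w'. G' (0, w') = (0, w)" for w by (rule directions(2)) (use GV KU in auto)

  \<comment> \<open>The derivative of \<open>X\<close> in the coordinates of the cylinder is computed in two ways: through the chart \<open>c\<close> by the
    chain rule, and by the product rule for \<open>\<gamma> \<psi>\<close>.\<close>
  let ?Y' = "chart_deriv c X p"
  let ?\<psi>' = "chart_deriv d \<psi> q"
  have cX: "smooth_on (snd c ` fst c) (X \<circ> chart_inv c)"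
    and d\<psi>: "smooth_on (snd d ` fst d) (\<psi> \<circ> chart_inv d)"
    using X \<psi> c(1) d(1) by (auto simp: smooth_immersion_def minimal_legendrian_immersion_def)
  have Y': "((X \<circ> chart_inv c) has_derivative ?Y') (at (G z) within snd c ` fst c)"
    unfolding Gz by (rule chart_deriv_works[OF cX]) (use c(2) in \<open>simp add: p_def\<close>)
  have \<psi>': "((\<psi> \<circ> chart_inv d) has_derivative ?\<psi>') (at (snd d q) within snd d ` fst d)"
    by (rule chart_deriv_works[OF d\<psi> d(2)])
  have V_S: "V \<subseteq> ?S" unfolding D_image[symmetric] V_def by blast
  have "U \<subseteq> snd c ` fst c" by (auto simp: U_def)
  then have "G ` V \<subseteq> snd c ` fst c" using GV by blast
  from diff_chain_within[OF G' has_derivative_subset[OF Y' this]]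
  have chain: "((X \<circ> chart_inv c \<circ> G) has_derivative (?Y' \<circ> G')) (at z within V)" .
  have "((\<lambda>y. \<gamma> (\<sigma> (fst y))) has_derivative (\<lambda>h. fst h *\<^sub>R b)) (at z within V)"
  proof (rule has_derivative_in_compose[of fst fst z V "\<lambda>t. \<gamma> (\<sigma> t)" "\<lambda>t. t *\<^sub>R b"])
    have "fst ` V \<subseteq> {0..<L}" using V_S by auto
    from has_derivative_subset[OF der[unfolded has_vector_derivative_def] this]
    show "((\<lambda>t. \<gamma> (\<sigma> t)) has_derivative (\<lambda>t. t *\<^sub>R b)) (at (fst z) within fst ` V)"
      by (simp add: z_def)
  qed (rule bounded_linear_imp_has_derivative[OF bounded_linear_fst])
  moreover have "((\<lambda>y. \<psi> (chart_inv d (snd y))) has_derivative (\<lambda>h. ?\<psi>' (snd h))) (at z within V)"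
  proof (rule has_derivative_in_compose[of snd snd z V "\<lambda>x. \<psi> (chart_inv d x)" ?\<psi>'])
    have "snd ` V \<subseteq> snd d ` fst d" using V_S by auto
    from has_derivative_subset[OF \<psi>' this]
    show "((\<lambda>x. \<psi> (chart_inv d x)) has_derivative ?\<psi>') (at (snd z) within snd ` V)"
      by (simp add: z_def comp_def)
  qed (rule bounded_linear_imp_has_derivative[OF bounded_linear_snd])
  ultimately have "((\<lambda>y. \<gamma> (\<sigma> (fst y)) *s \<psi> (chart_inv d (snd y))) has_derivative
      (\<lambda>h. \<gamma> (\<sigma> (fst z)) *s ?\<psi>' (snd h) + (fst h *\<^sub>R b) *s \<psi> (chart_inv d (snd z)))) (at z within V)"
    by (rule bounded_bilinear.FDERIV[OF bounded_bilinear_vector_scalar_mult])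
  then have "((X \<circ> chart_inv c \<circ> G) has_derivative
      (\<lambda>h. \<gamma> (\<sigma> (fst z)) *s ?\<psi>' (snd h) + (fst h *\<^sub>R b) *s \<psi> (chart_inv d (snd z)))) (at z within V)"
  proof (rule has_derivative_transform[OF z_V, rotated])
    fix y assume y: "y \<in> V"
    have yS: "fst y \<in> {0..<L}" "snd y \<in> snd d ` fst d" using y V_S by auto
    have inv: "chart_inv D y = (\<sigma> (fst y), chart_inv d (snd y))" using D_inv_eq(1)[OF yS] by simp
    obtain x where x: "x \<in> fst D" "\<Phi> x \<in> fst c" "y = snd D x" using y by (auto simp: V_def)
    have "(X \<circ> chart_inv c \<circ> G) y = X (\<Phi> (chart_inv D y))"
      using chart_inv_chart[OF cM x(2)] by (simp add: G_def x(3) D_inv[OF x(1)])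
    also have "\<dots> = \<gamma> (\<sigma> (fst y)) *s \<psi> (chart_inv d (snd y))"
      unfolding inv
      using yS range[OF yS(1)] d_sub chart_inv_chart[OF dN] by (intro prod) auto
    finally show "(X \<circ> chart_inv c \<circ> G) y = \<gamma> (\<sigma> (fst y)) *s \<psi> (chart_inv d (snd y))" .
  qed
  note unique = half_space_derivative_unique[OF V z_V chain this]
  have Y'G': "?Y' (G' h) = \<gamma> (\<sigma> 0) *s ?\<psi>' (snd h) + (fst h *\<^sub>R b) *s \<psi> q" for h
    using fun_cong[OF unique, of h] chart_inv_chart[OF dN d(2)] by (simp add: z_def)

  have linY: "linear ?Y'" using Y' by (rule has_derivative_linear)
  have lin\<psi>: "linear ?\<psi>'" using \<psi>' by (rule has_derivative_linear)
  have \<psi>_unit: "norm (\<psi> x) = 1" if "x \<in> topspace TN" for x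
    using \<psi> that by (auto simp: minimal_legendrian_immersion_def)
  have "(\<psi> \<circ> chart_inv d) (snd d q) \<bullet> ?\<psi>' w = 0" for w
    by (rule sphere_derivative_orthogonal[OF d_open(1) _ \<psi>'])
      (use d(2) d_sub chart_inv_chart[OF dN] in \<open>auto intro!: \<psi>_unit\<close>)
  then have orth\<psi>: "\<psi> q \<bullet> ?\<psi>' w = 0" for w using chart_inv_chart[OF dN d(2)] by simp
  have orthJ: "complex_structure (\<psi> q) \<bullet> ?\<psi>' w = 0" for w
    using \<psi> d by (auto simp: minimal_legendrian_immersion_def)
  show ?thesis
    unfolding p_def[symmetric]
  proof (rule outward_conormal_eqI[OF linY])
    show "- (b *s \<psi> q) = ?Y' (- G' (1, 0))"
      by (simp add: linear_neg[OF linY] Y'G' linear_0[OF lin\<psi>])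
    show "fst (- G' (1, 0)) < 0" using inward by simp
    show "norm (- (b *s \<psi> q)) = 1" by (simp add: norm_vector_scalar_mult unit(2) \<psi>_unit[OF q])
    fix w
    obtain w' where w': "G' (0, w') = (0, w)" using tangential by blast
    show "- (b *s \<psi> q) \<bullet> ?Y' (0, w) = 0"
      by (simp flip: w' add: Y'G' inner_vector_scalar_mult orth\<psi> orthJ)
  qed
qed


section \<open>The contact angles\<close>

text \<open>The first integral takes the value \<open>exp (- \<epsilon> / 2) * sin \<Theta>\<close> at both ends, where \<open>r = 1\<close>.
  The minimum of \<open>r\<close> is attained in the interior, so \<open>r' = cos \<Theta>\<close> vanishes there and
  the first integral equals its prefactor up to sign.\<close>

lemma profile_curve_end_angles:
  assumes \<gamma>: "profile_curve n \<epsilon> L \<gamma>"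
    and m: "m \<in> (\<lambda>s. cmod (\<gamma> s)) ` {0..L}" "\<And>s. s \<in> {0..L} \<Longrightarrow> m \<le> cmod (\<gamma> s)"
  obtains \<phi> \<alpha> where
    "\<And>s. s \<in> {0..L} \<Longrightarrow> \<gamma> s = of_real (cmod (\<gamma> s)) * cis (\<phi> s)"
    "\<And>s. s \<in> {0..L} \<Longrightarrow> (\<gamma> has_vector_derivative cis (\<alpha> s)) (at s within {0..L})"
    "\<And>s. s \<in> {0, L} \<Longrightarrow> \<bar>sin (\<alpha> s - \<phi> s)\<bar> = m ^ n * exp (\<epsilon> * (1 - m\<^sup>2) / 2)"
proof -
  have L: "0 < L" and ends: "cmod (\<gamma> 0) = 1" "cmod (\<gamma> L) = 1"
    and interior: "\<And>s. s \<in> {0<..<L} \<Longrightarrow> 0 < cmod (\<gamma> s) \<and> cmod (\<gamma> s) < 1"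
    using \<gamma> by (auto simp: profile_curve_def)
  obtain \<phi> \<alpha> E where polar: "\<And>s. s \<in> {0..L} \<Longrightarrow> \<gamma> s = of_real (cmod (\<gamma> s)) * cis (\<phi> s)"
    and velocity: "\<And>s. s \<in> {0..L} \<Longrightarrow> (\<gamma> has_vector_derivative cis (\<alpha> s)) (at s within {0..L})"
    and r': "\<And>s. s \<in> {0..L} \<Longrightarrow>
      ((\<lambda>t. cmod (\<gamma> t)) has_real_derivative cos (\<alpha> s - \<phi> s)) (at s within {0..L})"
    and E: "\<And>s. s \<in> {0..L} \<Longrightarrow>
      cmod (\<gamma> s) ^ n * exp (- \<epsilon> * (cmod (\<gamma> s))\<^sup>2 / 2) * sin (\<alpha> s - \<phi> s) = E"
    using \<gamma> unfolding profile_curve_def by blast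
  obtain s where s: "s \<in> {0..L}" "m = cmod (\<gamma> s)" using m(1) by blast
  have "m < 1" using m(2)[of "L / 2"] interior[of "L / 2"] L by auto
  then have s_int: "s \<in> {0<..<L}" using s ends by (cases "s = 0 \<or> s = L") auto
  then have m_pos: "0 < m" using interior s(2) by blast
  have "cos (\<alpha> s - \<phi> s) = 0"
  proof (rule DERIV_local_min)
    have "at s within {0..L} = at s" using s_int by (intro at_within_interior) simp
    then show "((\<lambda>t. cmod (\<gamma> t)) has_real_derivative cos (\<alpha> s - \<phi> s)) (at s)"
      using r'[OF s(1)] by simp
    show "0 < min s (L - s)" using s_int by simp
    show "\<forall>y. \<bar>s - y\<bar> < min s (L - s) \<longrightarrow> cmod (\<gamma> s) \<le> cmod (\<gamma> y)"
    proof (intro allI impI)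
      fix y assume "\<bar>s - y\<bar> < min s (L - s)"
      then have "y \<in> {0..L}" by auto
      then show "cmod (\<gamma> s) \<le> cmod (\<gamma> y)" using m(2) s(2) by simp
    qed
  qed
  then have "\<bar>sin (\<alpha> s - \<phi> s)\<bar> = 1"
    using sin_cos_squared_add[of "\<alpha> s - \<phi> s"] by (simp add: abs_square_eq_1)
  then have absE: "\<bar>E\<bar> = m ^ n * exp (- \<epsilon> * m\<^sup>2 / 2)"
    using E[OF s(1)] m_pos s(2) by (auto simp: abs_mult)
  show ?thesis
  proof (rule that[OF polar velocity])
    fix e assume e: "e \<in> {0, L}"
    then have "exp (- \<epsilon> / 2) * sin (\<alpha> e - \<phi> e) = E" using E[of e] ends L by auto
    then have "\<bar>exp (- \<epsilon> / 2) * sin (\<alpha> e - \<phi> e)\<bar> = m ^ n * exp (- \<epsilon> * m\<^sup>2 / 2)"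
      using absE by simp
    then have "exp (- \<epsilon> / 2) * \<bar>sin (\<alpha> e - \<phi> e)\<bar> = m ^ n * exp (- \<epsilon> * m\<^sup>2 / 2)"
      by (simp add: abs_mult)
    moreover have "exp (\<epsilon> / 2) * exp (- \<epsilon> / 2) = 1" by (simp flip: exp_add)
    ultimately have "\<bar>sin (\<alpha> e - \<phi> e)\<bar> = m ^ n * (exp (\<epsilon> / 2) * exp (- \<epsilon> * m\<^sup>2 / 2))"
      by (metis mult.assoc mult.left_commute mult_1)
    also have "exp (\<epsilon> / 2) * exp (- \<epsilon> * m\<^sup>2 / 2) = exp (\<epsilon> * (1 - m\<^sup>2) / 2)"
      by (simp add: field_simps flip: exp_add)
    finally show "\<bar>sin (\<alpha> e - \<phi> e)\<bar> = m ^ n * exp (\<epsilon> * (1 - m\<^sup>2) / 2)" .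
  qed
qed

text \<open>The derivative at \<open>t\<close> is \<open>t ^ (n - 1) * exp (\<epsilon> * (1 - t\<^sup>2) / 2) * (n - \<epsilon> * t\<^sup>2)\<close>, and
  \<open>\<epsilon> * t\<^sup>2 \<le> 1 \<le> n\<close> for \<open>0 \<le> t \<le> 1\<close>.\<close>

lemma power_times_gauss_mono:
  fixes x y \<epsilon> :: real
  assumes "0 \<le> x" "x \<le> y" "y \<le> 1" and n: "n \<ge> 1" "\<epsilon> \<le> 1"
  shows "x ^ n * exp (\<epsilon> * (1 - x\<^sup>2) / 2) \<le> y ^ n * exp (\<epsilon> * (1 - y\<^sup>2) / 2)"
proof (rule DERIV_nonneg_imp_nondecreasing[OF \<open>x \<le> y\<close>])
  fix t assume t: "x \<le> t" "t \<le> y"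
  let ?e = "exp (\<epsilon> * (1 - t\<^sup>2) / 2)"
  have "((\<lambda>t. t ^ n * exp (\<epsilon> * (1 - t\<^sup>2) / 2)) has_real_derivative
      real n * t ^ (n - 1) * ?e - t ^ n * (\<epsilon> * t * ?e)) (at t)"
    by (auto intro!: derivative_eq_intros simp: algebra_simps)
  note D = this
  have "t ^ n = t ^ (n - 1) * t" using n by (cases n) auto
  then have factor: "real n * t ^ (n - 1) * ?e - t ^ n * (\<epsilon> * t * ?e) =
      t ^ (n - 1) * ?e * (real n - \<epsilon> * t\<^sup>2)"
    by (simp add: algebra_simps power2_eq_square)
  have "\<epsilon> * t\<^sup>2 \<le> 1 * 1"
    using t assms by (intro mult_mono) (auto simp: power_le_one)
  then have "0 \<le> t ^ (n - 1) * ?e * (real n - \<epsilon> * t\<^sup>2)" using t assms n by simp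
  then show "\<exists>D. ((\<lambda>t. t ^ n * exp (\<epsilon> * (1 - t\<^sup>2) / 2)) has_real_derivative D) (at t) \<and> 0 \<le> D"
    using D unfolding factor by blast
qed

theorem corollary5p1:
  fixes \<epsilon> \<theta>\<^sub>0 \<theta>\<^sub>1 L r_min :: real
    and TM :: "'p topology" and A :: "('p, real \<times> (real^'m)) chart set"
    and X :: "'p \<Rightarrow> complex^'n"
    and \<Sigma>\<^sub>0 \<Sigma>\<^sub>1 :: "'p set"
    and TN :: "'q topology" and B :: "('q, real^'m) chart set"
    and \<psi> :: "'q \<Rightarrow> complex^'n"
    and \<gamma> :: "real \<Rightarrow> complex" and \<Phi> :: "real \<times> 'q \<Rightarrow> 'p"
  assumes dim: "CARD('n) \<ge> 2" "CARD('n) = CARD('m) + 1"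
    and eps: "\<epsilon> \<in> {-1, 0, 1}"
    and M: "smooth_manifold half_space TM A" "compact_space TM" "connected_space TM"
    and X: "smooth_immersion A X" "lagrangian A X"
    and soliton: "\<forall>c\<in>A. \<forall>p\<in>fst c. mean_curvature {} c X p + \<epsilon> *\<^sub>R position_normal c X p = 0"
    and ball: "X ` topspace TM \<subseteq> cball 0 1"
    and bdry: "X ` manifold_boundary A \<subseteq> sphere 0 1"
    and components:
      "connected_components_of (subtopology TM (manifold_boundary A)) = {\<Sigma>\<^sub>0, \<Sigma>\<^sub>1}" "\<Sigma>\<^sub>0 \<noteq> \<Sigma>\<^sub>1"
    and capillary: "legendrian_capillary A X \<Sigma>\<^sub>0 \<theta>\<^sub>0" "legendrian_capillary A X \<Sigma>\<^sub>1 \<theta>\<^sub>1"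
    and angles: "\<theta>\<^sub>0 \<in> {0<..<pi}" "\<theta>\<^sub>1 \<in> {0<..<pi}"
    and product: "global_product_form \<epsilon> TM A X TN B \<psi> L \<gamma> \<Phi>"
    and ends: "\<Phi> ` ({0} \<times> topspace TN) = \<Sigma>\<^sub>0" "\<Phi> ` ({L} \<times> topspace TN) = \<Sigma>\<^sub>1"
    and r_min: "r_min \<in> (\<lambda>s. cmod (\<gamma> s)) ` {0..L}" "\<forall>s\<in>{0..L}. r_min \<le> cmod (\<gamma> s)"
  shows "\<bar>cos \<theta>\<^sub>0\<bar> = r_min ^ CARD('n) * exp (\<epsilon> * (1 - r_min\<^sup>2) / 2) \<and>
         \<bar>cos \<theta>\<^sub>1\<bar> = r_min ^ CARD('n) * exp (\<epsilon> * (1 - r_min\<^sup>2) / 2) \<and>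
         (\<forall>\<rho>\<^sub>0>0. infdist 0 (X ` topspace TM) \<ge> \<rho>\<^sub>0 \<longrightarrow>
            \<bar>cos \<theta>\<^sub>0\<bar> \<ge> \<rho>\<^sub>0 ^ CARD('n) * exp (\<epsilon> * (1 - \<rho>\<^sub>0\<^sup>2) / 2) \<and>
            \<bar>cos \<theta>\<^sub>1\<bar> \<ge> \<rho>\<^sub>0 ^ CARD('n) * exp (\<epsilon> * (1 - \<rho>\<^sub>0\<^sup>2) / 2))"
proof -
  have L: "0 < L" and ends_r: "cmod (\<gamma> 0) = 1" "cmod (\<gamma> L) = 1"
    and prof: "profile_curve CARD('n) \<epsilon> L \<gamma>"
    and N: "smooth_manifold UNIV TN B" and \<psi>: "minimal_legendrian_immersion TN B \<psi>"
    and \<Phi>: "is_diffeomorphism (cylinder_topology L TN) (cylinder_atlas L B) TM A \<Phi>"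
    and prod: "\<And>s q. s \<in> {0..L} \<Longrightarrow> q \<in> topspace TN \<Longrightarrow> X (\<Phi> (s, q)) = \<gamma> s *s \<psi> q"
    using product by (auto simp: global_product_form_def profile_curve_def)
  have \<psi>_unit: "norm (\<psi> x) = 1" if "x \<in> topspace TN" for x
    using \<psi> that by (auto simp: minimal_legendrian_immersion_def)
  obtain \<phi> \<alpha> where polar: "\<And>s. s \<in> {0..L} \<Longrightarrow> \<gamma> s = of_real (cmod (\<gamma> s)) * cis (\<phi> s)"
    and velocity: "\<And>s. s \<in> {0..L} \<Longrightarrow> (\<gamma> has_vector_derivative cis (\<alpha> s)) (at s within {0..L})"
    and sin_end: "\<And>s. s \<in> {0, L} \<Longrightarrow>
      \<bar>sin (\<alpha> s - \<phi> s)\<bar> = r_min ^ CARD('n) * exp (\<epsilon> * (1 - r_min\<^sup>2) / 2)"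
    using profile_curve_end_angles[OF prof r_min(1)] r_min(2) by metis

  \<comment> \<open>\<open>k\<close> is the sign of the orientation of the curve relative to the inward direction.\<close>
  have angle: "\<bar>cos \<theta>\<bar> = \<bar>sin (\<alpha> (\<sigma> 0) - \<phi> (\<sigma> 0))\<bar>"
    if \<sigma>: "\<sigma> = (\<lambda>t. t) \<or> \<sigma> = (\<lambda>t. L - t)" and k: "k \<in> {1, -1}"
      and der: "((\<lambda>t. \<gamma> (\<sigma> t)) has_vector_derivative (of_real k * cis (\<alpha> (\<sigma> 0)))) (at 0 within {0..<L})"
      and \<Sigma>: "\<Phi> ` ({\<sigma> 0} \<times> topspace TN) = \<Sigma>" "\<Sigma> \<in> {\<Sigma>\<^sub>0, \<Sigma>\<^sub>1}"
      and cap: "legendrian_capillary A X \<Sigma> \<theta>"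
    for \<sigma> :: "real \<Rightarrow> real" and k \<theta> :: real and \<Sigma> :: "'p set"
  proof -
    have comp: "\<Sigma> \<in> connected_components_of (subtopology TM (manifold_boundary A))"
      using \<Sigma>(2) components(1) by simp
    obtain p where "p \<in> \<Sigma>" using nonempty_connected_components_of[OF comp] by blast
    then obtain q where q: "q \<in> topspace TN" "p = \<Phi> (\<sigma> 0, q)" using \<Sigma>(1) by blast
    have "p \<in> manifold_boundary A"
      using connected_components_of_subset[OF comp] \<open>p \<in> \<Sigma>\<close> by auto
    \<comment> \<open>A chart that witnesses that \<open>p\<close> is a boundary point; the conormal is computed in this one.\<close>
    then obtain c where c: "c \<in> A" "p \<in> fst c" "fst (snd c p) = 0"
      by (auto simp: manifold_boundary_def)
    have \<sigma>0: "\<sigma> 0 \<in> {0..L}" "cmod (\<gamma> (\<sigma> 0)) = 1" using \<sigma> ends_r L by auto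
    define b where "b = of_real k * cis (\<alpha> (\<sigma> 0))"
    have "cmod b = 1" using k by (auto simp: b_def norm_mult)
    then have "outward_conormal c X p = - (b *s \<psi> q)"
      unfolding q(2) using \<sigma>0(2) q c der
      by (intro outward_conormal_product[OF M(1) X(1) N \<psi> \<Phi> prod L \<sigma>]) (auto simp: b_def)
    moreover have "outward_conormal c X p = sin \<theta> *\<^sub>R X p + cos \<theta> *\<^sub>R complex_structure (X p)"
      using cap c \<open>p \<in> \<Sigma>\<close> by (auto simp: legendrian_capillary_def)
    moreover have "X p = \<gamma> (\<sigma> 0) *s \<psi> q" unfolding q(2) by (rule prod[OF \<sigma>0(1) q(1)])
    ultimately have "cos \<theta> = - Im (b * cnj (\<gamma> (\<sigma> 0)))"
      using \<psi>_unit[OF q(1)] \<sigma>0(2) by (intro capillary_angle[of _ "\<psi> q"]) auto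
    also have "\<gamma> (\<sigma> 0) = cis (\<phi> (\<sigma> 0))" using polar[OF \<sigma>0(1)] \<sigma>0(2) by simp
    finally show ?thesis using k by (auto simp: b_def sin_diff algebra_simps)
  qed

  have der0: "(\<gamma> has_vector_derivative cis (\<alpha> 0)) (at 0 within {0..<L})"
    using L by (intro has_vector_derivative_within_subset[OF velocity]) auto
  have cos0: "\<bar>cos \<theta>\<^sub>0\<bar> = \<bar>sin (\<alpha> 0 - \<phi> 0)\<bar>"
    by (rule angle[of "\<lambda>t. t" 1 \<Sigma>\<^sub>0]) (use der0 ends(1) capillary(1) in auto)

  have "((\<gamma> \<circ> (\<lambda>t. L - t)) has_vector_derivative (- 1 *\<^sub>R cis (\<alpha> L))) (at 0 within {0..<L})"
  proof (rule vector_diff_chain_within)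
    show "((\<lambda>t. L - t) has_vector_derivative - 1) (at 0 within {0..<L})"
      by (auto intro!: derivative_eq_intros)
    have "(\<gamma> has_vector_derivative cis (\<alpha> L)) (at L within (\<lambda>t. L - t) ` {0..<L})"
      using L by (intro has_vector_derivative_within_subset[OF velocity]) auto
    then show "(\<gamma> has_vector_derivative cis (\<alpha> L)) (at (L - 0) within (\<lambda>t. L - t) ` {0..<L})"
      by simp
  qed
  then have derL: "((\<lambda>t. \<gamma> (L - t)) has_vector_derivative - cis (\<alpha> L)) (at 0 within {0..<L})"
    by (simp add: comp_def)
  have "\<bar>cos \<theta>\<^sub>1\<bar> = \<bar>sin (\<alpha> (L - 0) - \<phi> (L - 0))\<bar>"
    by (rule angle[of "\<lambda>t. L - t" "- 1" \<Sigma>\<^sub>1]) (use derL ends(2) capillary(2) in auto)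
  then have cosL: "\<bar>cos \<theta>\<^sub>1\<bar> = \<bar>sin (\<alpha> L - \<phi> L)\<bar>" by simp

  have "\<rho> ^ CARD('n) * exp (\<epsilon> * (1 - \<rho>\<^sup>2) / 2) \<le> r_min ^ CARD('n) * exp (\<epsilon> * (1 - r_min\<^sup>2) / 2)"
    if \<rho>: "0 < \<rho>" "\<rho> \<le> infdist 0 (X ` topspace TM)" for \<rho>
  proof (rule power_times_gauss_mono)
    have "\<Sigma>\<^sub>0 \<noteq> {}"
      using components(1) nonempty_connected_components_of by blast
    then obtain q where q: "q \<in> topspace TN" using ends(1) by blast
    obtain s where s: "s \<in> {0..L}" "r_min = cmod (\<gamma> s)" using r_min(1) by blast
    have "continuous_map (cylinder_topology L TN) TM \<Phi>"
      using \<Phi> by (simp add: is_diffeomorphism_def smooth_map_def)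
    then have "\<Phi> (s, q) \<in> topspace TM"
      using s(1) q by (auto simp: continuous_map_def cylinder_topology_def)
    then have "infdist 0 (X ` topspace TM) \<le> dist 0 (X (\<Phi> (s, q)))" by (intro infdist_le) auto
    also have "\<dots> = r_min"
      using s q by (simp add: prod norm_vector_scalar_mult \<psi>_unit)
    finally show "\<rho> \<le> r_min" using \<rho>(2) by simp
    show "r_min \<le> 1" using r_min(2)[rule_format, of 0] ends_r(1) L by simp
  qed (use \<rho> dim(1) eps in auto)
  then show ?thesis using cos0 cosL sin_end[of 0] sin_end[of L] by auto
qed

end
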